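(* For a dotted composition $\alpha$, under the identification of $H_\alpha$ with the forest $t_\alpha$, the coproduct of $\mathbf{sNSym}$ is given by $$\Delta(t_{\alpha})=\sum_{c\in\mathrm{adm}(t_{\alpha})}\mathrm{sgn}(c)\,P^c(t_{\alpha})\otimes R^c(t_{\alpha}).$$
   Context: Let $\mathbb N=\{1,2,\ldots\}$ and $\dot{\mathbb N}_0=\{\dot0,\dot1,\dot2,\ldots\}$ (dotted copies of the nonnegative integers). A dotted composition is a finite tuple $\alpha=(\alpha_1,\ldots,\alpha_k)$ with entries in $\mathbb N\cup\dot{\mathbb N}_0$; $\mathrm{df}(\alpha)$ is the number of dotted entries. $\mathbf{sNSym}$ is the free associative unital $\mathbb Q$-algebra on generators $H_n$ ($n\ge1$) and $H_{\dot n}=\tilde H_n$ ($n\ge0$), with $H_0=1$ and basis $H_\alpha:=H_{\alpha_1}\cdots H_{\alpha_k}$; it is graded by $\mathrm{df}(H_\alpha)=\mathrm{df}(\alpha)$. The space $\mathbf{sNSym}\otimes\mathbf{sNSym}$ is an algebra via $(f_1\otimes g_1)(f_2\otimes g_2)=(-1)^{\mathrm{df}(g_1)\mathrm{df}(f_2)}f_1f_2\otimes g_1g_2$ for $\mathrm{df}$-homogeneous elements. The coproduct $\Delta$ is the algebra morphism with $\Delta(H_n)=\sum_{k=0}^nH_k\otimes H_{n-k}$ and $\Delta(\tilde H_n)=\sum_{k=0}^n(\tilde H_k\otimes H_{n-k}+H_{n-k}\otimes\tilde H_k)$. Trees. For $n\ge0$ let $t_n$ be the ladder tree with $n$ non-root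 nodes (a root with a single path of $n$ nodes above it; $t_0$ is a single root), identified with $H_n$ (so $t_0$ with $1$). Let $t_{\dot n}$ be the planar rooted tree obtained by gluing, at the root, a coloured ladder tree with one (coloured) non-root node, placed on the left, and $t_n$; it is identified with $\tilde H_n$. For $\alpha=(\alpha_1,\ldots,\alpha_k)$ the forest $t_\alpha=t_{\alpha_1}\cdots t_{\alpha_k}$ is identified with $H_\alpha$; products are concatenations of forests, with $t_0$ acting as unit. Cuts. A cut of a planar rooted tree $t$ is a set of edges of $t$; it is admissible if each branch (path from the root to a leaf) contains at most one edge of it (the empty cut is admissible). $\mathrm{adm}(t)$ is the set of admissible cuts. For an admissible cut $c$, $R^c(t)$ is the component containing the root after removing the edges of $c$, and $P^c(t)$ is the planar rooted tree obtained from $t$ by deleting the non-root nodes of $R^c(t)$ and contracting edges, so that each cut-off part is attached directly to the root (for the empty cut $P^c(t)=t_0$). An admissible cut of $t_\alpha$ is a tuple $c=(c_1,\ldots,c_k)$ with $c_i\in\mathrm{adm}(t_{\alpha_i})$, and $P^c(t_\alpha)=P^{c_1}(t_{\alpha_1})\cdots P^{c_k}(t_{\alpha_k})$, $R^c(t_\alpha)=R^{c_1}(t_{\alpha_1})\cdots R^{c_k}(t_{\alpha_k})$. Sign. Let $j=\mathrm{df}(\alpha)$. If $j=0$, $\mathrm{sgn}(c)=1$. If $j\ge1$, number the coloured nodes of $t_\alpha$ by $1,\ldots,j$ from left to right; $\sigma_c\in\mathfrak S_j$ is the permutation (in one-line notation) given by the sequence of these labels read from left to right first in $P^c(t_\alpha)$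 and then in $R^c(t_\alpha)$, and $\mathrm{sgn}(c)=\mathrm{sgn}(\sigma_c)$. *)

theory Defs
  imports
    Complex_Main
    "HOL-Library.Poly_Mapping"
    "HOL-Library.Sublist"
    "HOL-Combinatorics.Permutations"
begin

section \<open>Dotted compositions\<close>

typedef pos = "{n::nat. 0 < n}"
  by auto

datatype entry = Plain pos | Dotted nat

fun is_dotted :: "entry \<Rightarrow> bool" where
  "is_dotted (Plain n) = False"
| "is_dotted (Dotted n) = True"

text \<open>A wrapper around lists, so that concatenation can be made the monoid operation used by
  \<^typ>\<open>'a \<Rightarrow>\<^sub>0 'b\<close>.\<close>

datatype dcomp = DComp (entries: "entry list")

instantiation dcomp :: monoid_add
begin

definition "0 = DComp []"
definition "\<alpha> + \<beta> = DComp (entries \<alpha> @ entries \<beta>)"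

instance
  by standard (simp_all add: zero_dcomp_def plus_dcomp_def)

end

definition df :: "dcomp \<Rightarrow> nat" where
  "df \<alpha> = length (filter is_dotted (entries \<alpha>))"

lemma df_zero [simp]: "df 0 = 0"
  by (simp add: df_def zero_dcomp_def)

lemma df_plus [simp]: "df (\<alpha> + \<beta>) = df \<alpha> + df \<beta>"
  by (simp add: df_def plus_dcomp_def)


section \<open>The algebra sNSym and its coproduct\<close>

text \<open>The monoid algebra over the rationals of the free monoid of dotted compositions: the free
  associative unital algebra on the entries. Its product is the convolution product
  \<^term>\<open>(*)\<close> of the library.\<close>

type_synonym snsym = "dcomp \<Rightarrow>\<^sub>0 rat"

definition H_comp :: "dcomp \<Rightarrow> snsym" where
  "H_comp \<alpha> = Poly_Mapping.single \<alpha> 1"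

definition H :: "nat \<Rightarrow> snsym" where
  "H n = (if n = 0 then 1 else H_comp (DComp [Plain (Abs_pos n)]))"

definition Ht :: "nat \<Rightarrow> snsym" where
  "Ht n = H_comp (DComp [Dotted n])"

definition scale :: "rat \<Rightarrow> ('a \<Rightarrow>\<^sub>0 rat) \<Rightarrow> ('a \<Rightarrow>\<^sub>0 rat)" where
  "scale c f = Poly_Mapping.map ((*) c) f"

definition lin_ext :: "('a \<Rightarrow> ('b \<Rightarrow>\<^sub>0 rat)) \<Rightarrow> ('a \<Rightarrow>\<^sub>0 rat) \<Rightarrow> ('b \<Rightarrow>\<^sub>0 rat)" where
  "lin_ext b f = (\<Sum>a\<in>Poly_Mapping.keys f. scale (Poly_Mapping.lookup f a) (b a))"

text \<open>The tensor square is the space with basis the pairs \<open>(\<alpha>, \<beta>)\<close>, standing for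
  \<open>H_comp \<alpha> \<otimes> H_comp \<beta>\<close>. Its product is \<open>tmul\<close>, which carries the sign, and not the
  library's \<^term>\<open>(*)\<close>.\<close>

type_synonym snsym2 = "(dcomp \<times> dcomp) \<Rightarrow>\<^sub>0 rat"

definition tensor :: "snsym \<Rightarrow> snsym \<Rightarrow> snsym2" (infixl \<open>\<otimes>\<close> 75) where
  "f \<otimes> g = lin_ext (\<lambda>\<alpha>. lin_ext (\<lambda>\<beta>. Poly_Mapping.single (\<alpha>, \<beta>) 1) g) f"

definition tone :: snsym2 where
  "tone = 1 \<otimes> 1"

definition tmul :: "snsym2 \<Rightarrow> snsym2 \<Rightarrow> snsym2" (infixl \<open>\<odot>\<close> 70) where
  "X \<odot> Y = lin_ext (\<lambda>(\<alpha>1, \<beta>1). lin_ext (\<lambda>(\<alpha>2, \<beta>2).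
     Poly_Mapping.single (\<alpha>1 + \<alpha>2, \<beta>1 + \<beta>2) ((-1) ^ (df \<beta>1 * df \<alpha>2))) Y) X"

fun coproduct_gen :: "entry \<Rightarrow> snsym2" where
  "coproduct_gen (Plain m) = (let n = Rep_pos m in \<Sum>k=0..n. H k \<otimes> H (n - k))"
| "coproduct_gen (Dotted n) = (\<Sum>k=0..n. Ht k \<otimes> H (n - k) + H (n - k) \<otimes> Ht k)"

text \<open>The algebra morphism with the prescribed values on generators; see \<open>coproduct_H\<close>,
  \<open>coproduct_Ht\<close>, \<open>coproduct_one\<close> and \<open>coproduct_mult\<close> below.\<close>

definition coproduct :: "snsym \<Rightarrow> snsym2" where
  "coproduct = lin_ext (\<lambda>\<alpha>. foldr (\<lambda>e X. coproduct_gen e \<odot> X) (entries \<alpha>) tone)"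


subsection \<open>The algebra structure and the coproduct are the intended ones\<close>

lemma lookup_scale [simp]: "Poly_Mapping.lookup (scale c f) a = c * Poly_Mapping.lookup f a"
  unfolding scale_def by transfer (auto simp: when_def)

lemma scale_simps [simp]:
  "scale c 0 = 0" "scale 0 f = 0" "scale 1 f = f" "scale c (scale d f) = scale (c * d) f"
  "scale c (Poly_Mapping.single a d) = Poly_Mapping.single a (c * d)"
  by (auto intro!: poly_mapping_eqI simp: lookup_single when_def)

lemma scale_add: "scale c (f + g) = scale c f + scale c g"
  by (rule poly_mapping_eqI) (simp add: lookup_add algebra_simps)

lemma scale_add_left: "scale (c + d) f = scale c f + scale d f"
  by (rule poly_mapping_eqI) (simp add: lookup_add algebra_simps)

lemma scale_sum: "scale c (sum f A) = (\<Sum>a\<in>A. scale c (f a))"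
  by (induction A rule: infinite_finite_induct) (simp_all add: scale_add)

lemma lin_ext_superset:
  assumes "finite S" "Poly_Mapping.keys f \<subseteq> S"
  shows "lin_ext b f = (\<Sum>a\<in>S. scale (Poly_Mapping.lookup f a) (b a))"
  unfolding lin_ext_def using assms
  by (intro sum.mono_neutral_left) (auto simp: in_keys_iff)

lemma lin_ext_zero [simp]: "lin_ext b 0 = 0"
  by (simp add: lin_ext_def)

lemma lin_ext_single [simp]: "lin_ext b (Poly_Mapping.single a c) = scale c (b a)"
  by (subst lin_ext_superset[of "{a}"]) (auto split: if_splits)

lemma lin_ext_add: "lin_ext b (f + g) = lin_ext b f + lin_ext b g"
proof -
  let ?S = "Poly_Mapping.keys f \<union> Poly_Mapping.keys g"
  have "Poly_Mapping.keys (f + g) \<subseteq> ?S" by (rule Poly_Mapping.keys_add)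
  then show ?thesis
    by (simp add: lin_ext_superset[of ?S] lookup_add scale_add_left sum.distrib)
qed

lemma lin_ext_scale: "lin_ext b (scale c f) = scale c (lin_ext b f)"
proof -
  have "Poly_Mapping.keys (scale c f) \<subseteq> Poly_Mapping.keys f" by (auto simp: in_keys_iff)
  then show ?thesis
    by (simp add: lin_ext_superset[of "Poly_Mapping.keys f"] scale_sum)
qed

lemma lin_ext_add_fun: "lin_ext (\<lambda>a. b a + b' a) f = lin_ext b f + lin_ext b' f"
  by (simp add: lin_ext_def scale_add sum.distrib)

lemma lin_ext_scale_fun: "lin_ext (\<lambda>a. scale c (b a)) f = scale c (lin_ext b f)"
  by (simp add: lin_ext_def scale_sum mult.commute)

lemma lin_ext_cong:
  "(\<And>a. a \<in> Poly_Mapping.keys f \<Longrightarrow> b a = b' a) \<Longrightarrow> lin_ext b f = lin_ext b' f"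
  by (simp add: lin_ext_def)

lemma linear_induct [case_names zero single add]:
  fixes f :: "'a \<Rightarrow>\<^sub>0 rat"
  assumes "P 0" and single: "\<And>a c. P (Poly_Mapping.single a c)"
    and add: "\<And>f g. P f \<Longrightarrow> P g \<Longrightarrow> P (f + g)"
  shows "P f"
proof -
  have fin: "finite S \<Longrightarrow> P (\<Sum>a\<in>S. Poly_Mapping.single a (Poly_Mapping.lookup f a))" for S
    by (induction S rule: finite_induct) (auto intro: assms)
  have "f = (\<Sum>a\<in>Poly_Mapping.keys f. Poly_Mapping.single a (Poly_Mapping.lookup f a))"
    by (rule poly_mapping_eqI)
      (auto simp: lookup_sum lookup_single when_def in_keys_iff sum.delta)
  with fin[of "Poly_Mapping.keys f"] show ?thesis by simp
qed

lemma H_zero: "H 0 = 1"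
  by (simp add: H_def)

lemma H_comp_zero: "H_comp 0 = 1"
  by (simp add: H_comp_def)

lemma H_comp_plus: "H_comp (\<alpha> + \<beta>) = H_comp \<alpha> * H_comp \<beta>"
  by (simp add: H_comp_def mult_single)

lemma H_comp_eq_prod:
  "H_comp \<alpha> = prod_list (map (\<lambda>e. case e of Plain n \<Rightarrow> H (Rep_pos n) | Dotted n \<Rightarrow> Ht n) (entries \<alpha>))"
proof -
  have "H_comp (DComp es) =
      prod_list (map (\<lambda>e. case e of Plain n \<Rightarrow> H (Rep_pos n) | Dotted n \<Rightarrow> Ht n) es)" for es
  proof (induction es)
    case Nil
    then show ?case using H_comp_zero by (simp add: zero_dcomp_def)
  next
    case (Cons e es)
    have "DComp (e # es) = DComp [e] + DComp es" by (simp add: plus_dcomp_def)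
    moreover have "H (Rep_pos n) = H_comp (DComp [Plain n])" for n
      using Rep_pos[of n] by (auto simp: H_def Rep_pos_inverse)
    ultimately show ?case
      using Cons by (cases e) (simp_all add: H_comp_plus Ht_def)
  qed
  then show ?thesis by (cases \<alpha>) simp
qed

lemma tensor_add: "(f + f') \<otimes> g = f \<otimes> g + f' \<otimes> g" "f \<otimes> (g + g') = f \<otimes> g + f \<otimes> g'"
  by (simp_all add: tensor_def lin_ext_add lin_ext_add_fun)

lemma tensor_scale: "scale c f \<otimes> g = scale c (f \<otimes> g)" "f \<otimes> scale c g = scale c (f \<otimes> g)"
  by (simp_all add: tensor_def lin_ext_scale lin_ext_scale_fun)

lemma tensor_single:
  "Poly_Mapping.single \<alpha> c \<otimes> Poly_Mapping.single \<beta> d = Poly_Mapping.single (\<alpha>, \<beta>) (c * d)"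
  by (simp add: tensor_def)

lemma tensor_zero [simp]: "0 \<otimes> g = 0" "f \<otimes> 0 = 0"
  by (simp_all add: tensor_def lin_ext_def)

lemma tone_eq: "tone = Poly_Mapping.single (0, 0) 1"
proof -
  have "(1 :: snsym) = Poly_Mapping.single 0 1" by simp
  then show ?thesis unfolding tone_def by (metis tensor_single mult_1)
qed

lemma tmul_zero [simp]: "0 \<odot> Y = 0" "X \<odot> 0 = 0"
  by (simp_all add: tmul_def lin_ext_def case_prod_unfold)

lemma tmul_add: "(X + X') \<odot> Y = X \<odot> Y + X' \<odot> Y" "X \<odot> (Y + Y') = X \<odot> Y + X \<odot> Y'"
  by (simp_all add: tmul_def lin_ext_add lin_ext_add_fun case_prod_unfold)

lemma tmul_scale: "scale c X \<odot> Y = scale c (X \<odot> Y)" "X \<odot> scale c Y = scale c (X \<odot> Y)"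
  by (simp_all add: tmul_def lin_ext_scale lin_ext_scale_fun case_prod_unfold)

lemma tmul_single:
  "Poly_Mapping.single (\<alpha>1, \<beta>1) c \<odot> Poly_Mapping.single (\<alpha>2, \<beta>2) d =
     Poly_Mapping.single (\<alpha>1 + \<alpha>2, \<beta>1 + \<beta>2) ((-1) ^ (df \<beta>1 * df \<alpha>2) * c * d)"
  by (simp add: tmul_def mult_ac)

lemma tmul_assoc: "(X \<odot> Y) \<odot> Z = X \<odot> (Y \<odot> Z)"
proof (induction X rule: linear_induct)
  case (single p c)
  show ?case
  proof (induction Y rule: linear_induct)
    case (single q d)
    show ?case
    proof (induction Z rule: linear_induct)
      case (single r e)
      show ?case
        by (cases p; cases q; cases r) (simp add: tmul_single add.assoc power_add algebra_simps)
    qed (simp_all add: tmul_add)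
  qed (simp_all add: tmul_add)
qed (simp_all add: tmul_add)

lemma tmul_tone [simp]: "tone \<odot> X = X" "X \<odot> tone = X"
proof -
  show "tone \<odot> X = X"
  proof (induction X rule: linear_induct)
    case (single p c)
    show ?case by (cases p) (simp add: tone_eq tmul_single)
  qed (simp_all add: tmul_add)
  show "X \<odot> tone = X"
  proof (induction X rule: linear_induct)
    case (single p c)
    show ?case by (cases p) (simp add: tone_eq tmul_single)
  qed (simp_all add: tmul_add)
qed

definition homogeneous :: "nat \<Rightarrow> snsym \<Rightarrow> bool" where
  "homogeneous d f \<longleftrightarrow> (\<forall>\<alpha>\<in>Poly_Mapping.keys f. df \<alpha> = d)"

lemma tensor_eq_sum:
  "f \<otimes> g = (\<Sum>\<alpha>\<in>Poly_Mapping.keys f. \<Sum>\<beta>\<in>Poly_Mapping.keys g.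
     Poly_Mapping.single (\<alpha>, \<beta>) (Poly_Mapping.lookup f \<alpha> * Poly_Mapping.lookup g \<beta>))"
  by (simp add: tensor_def lin_ext_def scale_sum)

lemma tmul_tensor_single:
  "(f \<otimes> Poly_Mapping.single \<beta> c) \<odot> (Poly_Mapping.single \<alpha> d \<otimes> g) =
     scale ((-1) ^ (df \<beta> * df \<alpha>))
       ((f * Poly_Mapping.single \<alpha> d) \<otimes> (Poly_Mapping.single \<beta> c * g))"
proof (induction f rule: linear_induct)
  case (single a x)
  show ?case
  proof (induction g rule: linear_induct)
    case (single b y)
    show ?case by (simp add: tensor_single tmul_single mult_single mult_ac)
  qed (simp_all add: tensor_add tmul_add scale_add distrib_left distrib_right)
qed (simp_all add: tensor_add tmul_add scale_add distrib_left distrib_right)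

lemma tmul_tensor:
  assumes "homogeneous d g1" "homogeneous e f2"
  shows "(f1 \<otimes> g1) \<odot> (f2 \<otimes> g2) = scale ((-1) ^ (d * e)) ((f1 * f2) \<otimes> (g1 * g2))"
proof -
  have dec: "f = (\<Sum>a\<in>Poly_Mapping.keys f. Poly_Mapping.single a (Poly_Mapping.lookup f a))"
    for f :: snsym
    by (rule poly_mapping_eqI)
      (auto simp: lookup_sum lookup_single when_def in_keys_iff sum.delta)
  have tsum: "f \<otimes> sum h A = (\<Sum>a\<in>A. f \<otimes> h a)" "sum h A \<otimes> f = (\<Sum>a\<in>A. h a \<otimes> f)"
    for f and h :: "dcomp \<Rightarrow> snsym" and A
    by (induction A rule: infinite_finite_induct; simp add: tensor_add)+
  have msum: "X \<odot> sum h A = (\<Sum>a\<in>A. X \<odot> h a)" "sum h A \<odot> X = (\<Sum>a\<in>A. h a \<odot> X)"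
    for X and h :: "dcomp \<Rightarrow> snsym2" and A
    by (induction A rule: infinite_finite_induct; simp add: tmul_add)+
  let ?s = "\<lambda>(f::snsym) a. Poly_Mapping.single a (Poly_Mapping.lookup f a)"
  let ?g = "Poly_Mapping.keys g1" and ?f = "Poly_Mapping.keys f2"
  have "(f1 \<otimes> sum (?s g1) ?g) \<odot> (sum (?s f2) ?f \<otimes> g2) =
      (\<Sum>a\<in>?f. \<Sum>b\<in>?g. scale ((-1) ^ (d * e)) ((f1 * ?s f2 a) \<otimes> (?s g1 b * g2)))"
    unfolding tsum msum using assms
    by (simp add: tmul_tensor_single homogeneous_def)
  also have "\<dots> = scale ((-1) ^ (d * e)) ((f1 * sum (?s f2) ?f) \<otimes> (sum (?s g1) ?g * g2))"
    unfolding sum_distrib_left sum_distrib_right tsum scale_sum by (rule sum.swap)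
  finally show ?thesis using dec[of g1] dec[of f2] by simp
qed

lemma coproduct_add: "coproduct (f + g) = coproduct f + coproduct g"
  by (simp add: coproduct_def lin_ext_add)

lemma coproduct_scale: "coproduct (scale c f) = scale c (coproduct f)"
  by (simp add: coproduct_def lin_ext_scale)

lemma coproduct_zero [simp]: "coproduct 0 = 0"
  by (simp add: coproduct_def)

lemma coproduct_one: "coproduct 1 = tone"
proof -
  have "(1 :: snsym) = Poly_Mapping.single 0 1" by simp
  then show ?thesis by (metis coproduct_def lin_ext_single scale_simps(3) zero_dcomp_def
    dcomp.sel foldr.simps(1) id_apply)
qed

lemma coproduct_mult: "coproduct (f * g) = coproduct f \<odot> coproduct g"
proof (induction f rule: linear_induct)
  case (single a x)
  have app: "foldr (\<lambda>e X. coproduct_gen e \<odot> X) (es @ es') tone =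
      foldr (\<lambda>e X. coproduct_gen e \<odot> X) es tone \<odot> foldr (\<lambda>e X. coproduct_gen e \<odot> X) es' tone"
    for es es'
    by (induction es) (simp_all only: append_Nil append_Cons foldr.simps comp_apply id_apply
      tmul_tone tmul_assoc)
  show ?case
  proof (induction g rule: linear_induct)
    case (single b y)
    show ?case
      by (simp add: coproduct_def mult_single tmul_scale plus_dcomp_def app mult_ac del: foldr_append)
  qed (simp_all add: coproduct_add tmul_add distrib_left)
qed (simp_all add: coproduct_add tmul_add distrib_right)

lemma coproduct_H: "coproduct (H n) = (\<Sum>k=0..n. H k \<otimes> H (n - k))"
proof (cases "n = 0")
  case True
  then show ?thesis by (simp add: H_zero coproduct_one tone_def)
next
  case False
  then show ?thesis
    by (simp add: H_def[of n] coproduct_def H_comp_def Abs_pos_inverse Let_def)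
qed

lemma coproduct_Ht: "coproduct (Ht n) = (\<Sum>k=0..n. Ht k \<otimes> H (n - k) + H (n - k) \<otimes> Ht k)"
  by (simp add: Ht_def[of n] coproduct_def H_comp_def)


section \<open>Planar rooted trees and forests\<close>

text \<open>Every node carries a decoration: \<^typ>\<open>bool\<close> for uncoloured/coloured, and later
  \<^typ>\<open>nat option\<close> for uncoloured/coloured with a label.\<close>

datatype 'a ptree = Node 'a "'a ptree list"

fun glue :: "'a ptree \<Rightarrow> 'a ptree \<Rightarrow> 'a ptree" where
  "glue (Node x ss) (Node y ts) = Node x (ss @ ts)"

fun ladder :: "nat \<Rightarrow> bool ptree" where
  "ladder 0 = Node False []"
| "ladder (Suc n) = Node False [ladder n]"

definition dladder :: "nat \<Rightarrow> bool ptree" where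
  "dladder n = glue (Node False [Node True []]) (ladder n)"

fun entry_tree :: "entry \<Rightarrow> bool ptree" where
  "entry_tree (Plain n) = ladder (Rep_pos n)"
| "entry_tree (Dotted n) = dladder n"

definition comp_forest :: "dcomp \<Rightarrow> bool ptree list" where
  "comp_forest \<alpha> = map entry_tree (entries \<alpha>)"

text \<open>The identification of \<^term>\<open>ladder n\<close> with \<^term>\<open>H n\<close> and of \<^term>\<open>dladder n\<close> with
  \<^term>\<open>Ht n\<close>. It is only meaningful on these trees; by \<open>trunk_ladder\<close>, \<open>pruned_ladder\<close>,
  \<open>trunk_dladder\<close> and \<open>pruned_dladder\<close> below, no other tree arises from them by cutting.\<close>

definition tree_elt :: "bool ptree \<Rightarrow> snsym" where
  "tree_elt t = (if t \<in> range ladder then H (inv ladder t) else Ht (inv dladder t))"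

definition forest_elt :: "bool ptree list \<Rightarrow> snsym" where
  "forest_elt ts = prod_list (map tree_elt ts)"


section \<open>Cuts\<close>

text \<open>Nodes are addressed by the list of child indices on the path from the root. An edge is
  represented by the address of its upper end, so edges are the addresses of non-root nodes.\<close>

fun subtree :: "'a ptree \<Rightarrow> nat list \<Rightarrow> 'a ptree option" where
  "subtree t [] = Some t"
| "subtree (Node x ts) (i # p) = (if i < length ts then subtree (ts ! i) p else None)"

definition edges :: "'a ptree \<Rightarrow> nat list set" where
  "edges t = {p. p \<noteq> [] \<and> subtree t p \<noteq> None}"

definition leaves :: "'a ptree \<Rightarrow> nat list set" where
  "leaves t = {p. \<exists>x. subtree t p = Some (Node x [])}"

definition branch :: "nat list \<Rightarrow> nat list set" where
  "branch p = {q. q \<noteq> [] \<and> prefix q p}"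

definition adm :: "'a ptree \<Rightarrow> nat list set set" where
  "adm t = {c. c \<subseteq> edges t \<and> (\<forall>p\<in>leaves t. card (c \<inter> branch p) \<le> 1)}"

text \<open>\<open>trunk c t\<close> is the component of the root. In the auxiliary function on lists, \<open>i\<close> is the
  index of the first listed subtree among its siblings.\<close>

fun trunk :: "nat list set \<Rightarrow> 'a ptree \<Rightarrow> 'a ptree"
  and trunk_list :: "nat list set \<Rightarrow> nat \<Rightarrow> 'a ptree list \<Rightarrow> 'a ptree list" where
  "trunk c (Node x ts) = Node x (trunk_list c 0 ts)"
| "trunk_list c i [] = []"
| "trunk_list c i (t # ts) =
     (if [i] \<in> c then [] else [trunk {q. i # q \<in> c} t]) @ trunk_list c (Suc i) ts"

text \<open>The cut-off subtrees, in their planar (left to right) order. A subtree that has been cut off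
  is not searched for further cut edges: there are none if the cut is admissible.\<close>

fun cut_off :: "nat list set \<Rightarrow> 'a ptree \<Rightarrow> 'a ptree list"
  and cut_off_list :: "nat list set \<Rightarrow> nat \<Rightarrow> 'a ptree list \<Rightarrow> 'a ptree list" where
  "cut_off c (Node x ts) = cut_off_list c 0 ts"
| "cut_off_list c i [] = []"
| "cut_off_list c i (t # ts) =
     (if [i] \<in> c then [t] else cut_off {q. i # q \<in> c} t) @ cut_off_list c (Suc i) ts"

fun pruned :: "nat list set \<Rightarrow> 'a ptree \<Rightarrow> 'a ptree" where
  "pruned c (Node x ts) = Node x (cut_off c (Node x ts))"

definition adm_forest :: "'a ptree list \<Rightarrow> nat list set list set" where
  "adm_forest ts = {cs. list_all2 (\<lambda>c t. c \<in> adm t) cs ts}"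

definition R_cut :: "nat list set list \<Rightarrow> 'a ptree list \<Rightarrow> 'a ptree list" where
  "R_cut cs ts = map2 trunk cs ts"

definition P_cut :: "nat list set list \<Rightarrow> 'a ptree list \<Rightarrow> 'a ptree list" where
  "P_cut cs ts = map2 pruned cs ts"


section \<open>The sign of a cut\<close>

text \<open>Nodes are read from left to right in preorder. In the trees \<^term>\<open>dladder n\<close> there is a
  single coloured node, so only the order of the trees matters for coloured nodes.\<close>

fun preorder :: "'a ptree \<Rightarrow> 'a list" where
  "preorder (Node x ts) = x # concat (map preorder ts)"

text \<open>\<open>number_list k ts\<close> labels the coloured nodes of the forest \<open>ts\<close> by \<open>k, k + 1, \<dots>\<close>.\<close>

fun number :: "nat \<Rightarrow> bool ptree \<Rightarrow> nat option ptree"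
  and number_list :: "nat \<Rightarrow> bool ptree list \<Rightarrow> nat option ptree list" where
  "number k (Node b ts) =
     Node (if b then Some k else None) (number_list (if b then Suc k else k) ts)"
| "number_list k [] = []"
| "number_list k (t # ts) =
     number k t # number_list (k + length (filter (\<lambda>b. b) (preorder t))) ts"

definition labels :: "nat option ptree list \<Rightarrow> nat list" where
  "labels ts = [i. Some i \<leftarrow> concat (map preorder ts)]"

definition one_line :: "nat list \<Rightarrow> nat \<Rightarrow> nat" where
  "one_line w i = (if 1 \<le> i \<and> i \<le> length w then w ! (i - 1) else i)"

text \<open>If the forest has no coloured nodes, the permutation is the identity and the sign is 1.\<close>

definition sgn_cut :: "bool ptree list \<Rightarrow> nat list set list \<Rightarrow> rat" where
  "sgn_cut ts cs = (let ns = number_list 1 ts in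
     of_int (sign (one_line (labels (P_cut cs ns) @ labels (R_cut cs ns)))))"


subsection \<open>Sanity checks on trees and cuts\<close>

lemma inj_ladder: "inj ladder"
proof (rule injI)
  show "ladder m = ladder n \<Longrightarrow> m = n" for m n
    by (induction m arbitrary: n; case_tac n) auto
qed

lemma root_ladder: "\<exists>ts. ladder n = Node False ts \<and> (\<forall>us. ts \<noteq> Node True [] # us)"
  by (cases n; cases "n - 1") auto

lemma inj_dladder: "inj dladder"
proof (rule injI)
  fix m n assume "dladder m = dladder n"
  then have "ladder m = ladder n"
    using root_ladder[of m] root_ladder[of n] by (auto simp: dladder_def)
  then show "m = n" using inj_ladder by (simp add: inj_eq)
qed

lemma tree_elt_ladder: "tree_elt (ladder n) = H n"
  by (simp add: tree_elt_def inj_ladder)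

lemma tree_elt_dladder: "tree_elt (dladder n) = Ht n"
proof -
  have "dladder n \<notin> range ladder"
  proof
    assume "dladder n \<in> range ladder"
    then obtain m where "dladder n = ladder m" by auto
    then show False using root_ladder[of m] root_ladder[of n] by (auto simp: dladder_def)
  qed
  then show ?thesis by (simp add: tree_elt_def inj_dladder)
qed

lemma forest_elt_comp_forest: "forest_elt (comp_forest \<alpha>) = H_comp \<alpha>"
proof -
  have "tree_elt (entry_tree e) = (case e of Plain n \<Rightarrow> H (Rep_pos n) | Dotted n \<Rightarrow> Ht n)" for e
    by (cases e) (simp_all add: tree_elt_ladder tree_elt_dladder)
  then show ?thesis by (simp add: forest_elt_def comp_forest_def H_comp_eq_prod comp_def)
qed

lemma ladder_simps: "Node False [] = ladder 0" "Node False [ladder m] = ladder (Suc m)"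
  by simp_all

lemma trunk_ladder: "trunk c (ladder n) \<in> range ladder"
proof (induction n arbitrary: c)
  case 0
  have "trunk c (ladder 0) = ladder 0" by simp
  then show ?case by (metis rangeI)
next
  case (Suc n)
  obtain m where m: "trunk {q. 0 # q \<in> c} (ladder n) = ladder m" using Suc by blast
  have "trunk c (ladder (Suc n)) = (if [0] \<in> c then ladder 0 else ladder (Suc m))"
    using m by simp
  then show ?case by (metis rangeI)
qed

lemma cut_off_ladder: "cut_off c (ladder n) = [] \<or> (\<exists>m. cut_off c (ladder n) = [ladder m])"
  by (induction n arbitrary: c) auto

lemma pruned_eq: "pruned c (ladder n) = Node False (cut_off c (ladder n))"
  by (cases n) simp_all

lemma pruned_ladder: "pruned c (ladder n) \<in> range ladder"
  using cut_off_ladder[of c n] ladder_simps by (metis pruned_eq rangeI)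

lemma dladder_eq:
  "ladder n = Node False ts \<Longrightarrow> dladder n = Node False (Node True [] # ts)"
  by (simp add: dladder_def)

lemma ladder_or_dladder:
  assumes "xs = [] \<or> xs = [Node True []]" "ts = [] \<or> (\<exists>m. ts = [ladder m])"
  shows "Node False (xs @ ts) \<in> range ladder \<union> range dladder"
proof -
  obtain k where k: "ladder k = Node False ts"
    using assms(2) ladder_simps by metis
  show ?thesis
    using assms(1) k dladder_eq[OF k] by (auto simp: image_iff) metis+
qed

lemma trunk_dladder: "trunk c (dladder n) \<in> range ladder \<union> range dladder"
proof -
  obtain ts where n: "ladder n = Node False ts" and ts: "ts = [] \<or> (\<exists>m. ts = [ladder m])"
    by (cases n) auto
  have "trunk_list c 1 ts = [] \<or> (\<exists>m. trunk_list c 1 ts = [ladder m])"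
  proof (cases "ts = [] \<or> [1] \<in> c")
    case False
    then obtain m where "ts = [ladder m]" using ts by auto
    moreover obtain k where "trunk {q. 1 # q \<in> c} (ladder m) = ladder k"
      using trunk_ladder by blast
    ultimately show ?thesis using False by auto
  qed (use ts in auto)
  then have "Node False ((if [0] \<in> c then [] else [Node True []]) @ trunk_list c 1 ts)
      \<in> range ladder \<union> range dladder"
    by (intro ladder_or_dladder) auto
  then show ?thesis by (cases "[0] \<in> c") (simp_all add: dladder_eq[OF n])
qed

lemma pruned_dladder: "pruned c (dladder n) \<in> range ladder \<union> range dladder"
proof -
  obtain ts where n: "ladder n = Node False ts" and ts: "ts = [] \<or> (\<exists>m. ts = [ladder m])"
    by (cases n) auto
  have "cut_off_list c 1 ts = [] \<or> (\<exists>m. cut_off_list c 1 ts = [ladder m])"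
  proof (cases "ts = []")
    case False
    then obtain m where m: "ts = [ladder m]" using ts by auto
    then show ?thesis using cut_off_ladder[of "{q. 1 # q \<in> c}" m]
      by (cases "[1] \<in> c") (simp_all, blast)
  qed simp
  then have "Node False ((if [0] \<in> c then [Node True []] else []) @ cut_off_list c 1 ts)
      \<in> range ladder \<union> range dladder"
    by (intro ladder_or_dladder) auto
  then show ?thesis by (cases "[0] \<in> c") (simp_all add: dladder_eq[OF n])
qed

lemma finite_subtree: "finite {p. subtree t p \<noteq> None}"
proof (induction t)
  case (Node x ts)
  have "{p. subtree (Node x ts) p \<noteq> None} \<subseteq>
      insert [] (\<Union>i<length ts. (#) i ` {p. subtree (ts ! i) p \<noteq> None})"
  proof
    fix p assume "p \<in> {p. subtree (Node x ts) p \<noteq> None}"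
    then show "p \<in> insert [] (\<Union>i<length ts. (#) i ` {p. subtree (ts ! i) p \<noteq> None})"
      by (cases p) (auto split: if_splits)
  qed
  moreover have "finite (insert [] (\<Union>i<length ts. (#) i ` {p. subtree (ts ! i) p \<noteq> None}))"
    using Node by (intro finite.insertI finite_UN_I) auto
  ultimately show ?case by (rule finite_subset)
qed

lemma finite_adm: "finite (adm t)"
proof (rule finite_subset)
  show "adm t \<subseteq> Pow (edges t)" by (auto simp: adm_def)
  show "finite (Pow (edges t))"
    using finite_subset[OF _ finite_subtree, of "edges t" t] by (auto simp: edges_def)
qed

lemma finite_adm_forest: "finite (adm_forest ts)"
proof (rule finite_subset)
  show "adm_forest ts \<subseteq> {cs. set cs \<subseteq> (\<Union>t\<in>set ts. adm t) \<and> length cs = length ts}"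
    by (auto simp: adm_forest_def list_all2_conv_all_nth in_set_conv_nth intro!: bexI[OF _ nth_mem])
  show "finite {cs. set cs \<subseteq> (\<Union>t\<in>set ts. adm t) \<and> length cs = length ts}"
    by (intro finite_lists_length_eq finite_UN_I finite_adm) auto
qed

end

theory Submission
  imports Defs
begin

text \<open>
  Both sides are multiplicative along the forest, so everything reduces to a single tree and to
  what happens when one more tree is put in front.

  On a single tree the admissible cuts are listed by recursion over the children of the root:
  either the edge to a child is cut, and then nothing above it, or the cut restricts to an
  admissible cut of the child (\<open>adm_Node\<close>, \<open>sum_adm_Node_Cons\<close>). A ladder with \<open>n\<close> edges therefore
  has one cut for every splitting \<open>n = k + (n - k)\<close>. In the tree of \<open>Ht n\<close> the coloured node
  may moreover go to either side, independently of the cut of the ladder, which gives the two terms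
  for every \<open>k\<close> in the coproduct of \<open>Ht n\<close> (\<open>sum_adm_ladder\<close>, \<open>sum_adm_dladder\<close>).

  Since the coproduct is multiplicative, putting a tree \<open>t\<close> in front of a forest multiplies
  \<open>P \<otimes> R\<close> from the left by \<open>P' \<otimes> R'\<close>, where \<open>P'\<close> and \<open>R'\<close> are the parts of \<open>t\<close>. The product of
  the tensor square contributes the sign \<open>(-1) ^ (df R' * df P)\<close>. This is exactly the change of
  the sign of the permutation: \<open>t\<close> has at most one coloured node, its label is smaller than
  all the others, and if it lies in \<open>R'\<close>, it is read after the labels of \<open>P\<close>, so it creates
  \<open>df P\<close> new inversions and otherwise none (\<open>sgn_cut_Cons\<close>).
\<close>

section \<open>Admissible cuts, child by child\<close>

lemma leaves_Cons: "i # p \<in> leaves (Node x ts) \<longleftrightarrow> i < length ts \<and> p \<in> leaves (ts ! i)"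
  by (auto simp: leaves_def)

lemma edges_Cons: "i # p \<in> edges (Node x ts) \<longleftrightarrow> i < length ts \<and> (p = [] \<or> p \<in> edges (ts ! i))"
  by (cases p) (auto simp: edges_def)

lemma Nil_notin_edges [simp]: "[] \<notin> edges t"
  by (simp add: edges_def)

lemma branch_Cons: "branch (i # p) = (#) i ` insert [] (branch p)"
  by (auto simp: branch_def prefix_Cons image_iff)

lemma node_below_leaf: "subtree t p \<noteq> None \<Longrightarrow> \<exists>q\<in>leaves t. prefix p q"
proof (induction t arbitrary: p)
  case (Node x ts)
  show ?case
  proof (cases p)
    case Nil
    show ?thesis
    proof (cases ts)
      case Nil
      then have "[] \<in> leaves (Node x ts)" by (simp add: leaves_def)
      then show ?thesis using \<open>p = []\<close> by auto
    next
      case (Cons t us)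
      then obtain q where "q \<in> leaves t" using Node.IH[of t "[]"] by auto
      then have "0 # q \<in> leaves (Node x ts)" using Cons by (simp add: leaves_Cons)
      then show ?thesis using \<open>p = []\<close> by auto
    qed
  next
    case (Cons i p')
    with Node.prems have i: "i < length ts" and "subtree (ts ! i) p' \<noteq> None"
      by (auto split: if_splits)
    then obtain q where "q \<in> leaves (ts ! i)" "prefix p' q"
      using Node.IH[OF nth_mem] by blast
    then show ?thesis using i Cons by (intro bexI[of _ "i # q"]) (auto simp: leaves_Cons)
  qed
qed

text \<open>The set \<open>C\<close> stands for the part of a cut on one child \<open>t\<close> of the root, where \<open>[]\<close> is the edge
  from the root to \<open>t\<close>. Every node of \<open>t\<close> lies below some leaf, and every branch through \<open>t\<close> uses
  that edge, so cutting it excludes any further edge.\<close>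

lemma Nil_in_adm_child:
  assumes "C \<subseteq> insert [] (edges t)" "[] \<in> C"
  shows "(\<forall>p\<in>leaves t. card (C \<inter> insert [] (branch p)) \<le> 1) \<longleftrightarrow> C = {[]}"
proof
  assume *: "\<forall>p\<in>leaves t. card (C \<inter> insert [] (branch p)) \<le> 1"
  show "C = {[]}"
  proof (rule ccontr)
    assume "C \<noteq> {[]}"
    then obtain p where p: "p \<in> C" "p \<noteq> []" "p \<in> edges t" using assms by auto
    then obtain q where q: "q \<in> leaves t" "prefix p q"
      using node_below_leaf[of t p] by (auto simp: edges_def)
    have "finite (branch q)" by (rule finite_subset[of _ "set (prefixes q)"]) (auto simp: branch_def)
    then have "card {[], p} \<le> card (C \<inter> insert [] (branch q))"
      using p q assms(2) by (intro card_mono) (auto simp: branch_def)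
    then show False using * q(1) p(2) by force
  qed
next
  assume "C = {[]}"
  then show "\<forall>p\<in>leaves t. card (C \<inter> insert [] (branch p)) \<le> 1" by simp
qed

text \<open>Every branch stays within one child of the root, so admissibility can be tested
  on each child separately.\<close>

lemma adm_Node:
  "c \<in> adm (Node x ts) \<longleftrightarrow>
     [] \<notin> c \<and> (\<forall>i q. i # q \<in> c \<longrightarrow> i < length ts) \<and>
     (\<forall>i<length ts. {q. i # q \<in> c} \<in> insert {[]} (adm (ts ! i)))"
proof -
  have sub: "c \<subseteq> edges (Node x ts) \<longleftrightarrow> [] \<notin> c \<and> (\<forall>i q. i # q \<in> c \<longrightarrow> i < length ts) \<and>
      (\<forall>i<length ts. {q. i # q \<in> c} \<subseteq> insert [] (edges (ts ! i)))" (is "?L = ?R")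
  proof
    assume L: ?L
    have "i # q \<in> c \<Longrightarrow> i < length ts \<and> (q = [] \<or> q \<in> edges (ts ! i))" for i q
      using subsetD[OF L, of "i # q"] by (simp add: edges_Cons)
    moreover have "[] \<notin> c" using L by auto
    ultimately show ?R by simp blast
  next
    assume R: ?R
    show ?L
    proof
      fix p assume "p \<in> c"
      then show "p \<in> edges (Node x ts)" using R by (cases p) (auto simp: edges_Cons)
    qed
  qed
  have cnt: "card (c \<inter> branch (i # p)) = card ({q. i # q \<in> c} \<inter> insert [] (branch p))" for i p
  proof -
    have "c \<inter> branch (i # p) = (#) i ` ({q. i # q \<in> c} \<inter> insert [] (branch p))"
      unfolding branch_Cons by auto
    then show ?thesis by (simp add: card_image)
  qed
  have lv: "(\<forall>p\<in>leaves (Node x ts). card (c \<inter> branch p) \<le> 1) \<longleftrightarrow>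
      (\<forall>i<length ts. \<forall>p\<in>leaves (ts ! i). card ({q. i # q \<in> c} \<inter> insert [] (branch p)) \<le> 1)"
    (is "?L = ?R")
  proof
    assume L: ?L
    show ?R
    proof (intro allI impI ballI)
      fix i p assume "i < length ts" "p \<in> leaves (ts ! i)"
      then have "i # p \<in> leaves (Node x ts)" by (simp add: leaves_Cons)
      then show "card ({q. i # q \<in> c} \<inter> insert [] (branch p)) \<le> 1" using L cnt by metis
    qed
  next
    assume R: ?R
    show ?L
    proof
      fix p assume p: "p \<in> leaves (Node x ts)"
      show "card (c \<inter> branch p) \<le> 1"
      proof (cases p)
        case Nil
        then have "branch p = {}" by (auto simp: branch_def)
        then show ?thesis by simp
      next
        case (Cons i q)
        then show ?thesis using R p by (simp only: cnt leaves_Cons)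
      qed
    qed
  qed
  have loc: "C \<subseteq> insert [] (edges t) \<and>
      (\<forall>p\<in>leaves t. card (C \<inter> insert [] (branch p)) \<le> 1) \<longleftrightarrow> C \<in> insert {[]} (adm t)" for C and t :: "'a ptree"
  proof (cases "[] \<in> C")
    case True
    then have "C \<notin> adm t" by (auto simp: adm_def)
    then show ?thesis using Nil_in_adm_child[OF _ True, of t] by auto
  next
    case False
    then show ?thesis by (auto simp: adm_def)
  qed
  have "(\<forall>i<length ts. {q. i # q \<in> c} \<in> insert {[]} (adm (ts ! i))) \<longleftrightarrow>
      (\<forall>i<length ts. {q. i # q \<in> c} \<subseteq> insert [] (edges (ts ! i))) \<and>
      (\<forall>i<length ts. \<forall>p\<in>leaves (ts ! i). card ({q. i # q \<in> c} \<inter> insert [] (branch p)) \<le> 1)"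
    unfolding loc[symmetric] by (simp only: imp_conjR all_conj_distrib)
  then show ?thesis
    unfolding adm_def[of "Node x ts"] mem_Collect_eq sub lv by (simp only: conj_assoc)
qed

text \<open>The index in the auxiliary functions only serves to find the edges of the cut. This allows the
  remaining children to be renumbered from \<open>0\<close> once the first one is split off.\<close>

lemma cut_list_shift:
  assumes "\<And>k q. (i + k) # q \<in> c \<longleftrightarrow> (j + k) # q \<in> d"
  shows "cut_off_list c i ts = cut_off_list d j ts \<and> trunk_list c i ts = trunk_list d j ts"
  using assms
proof (induction ts arbitrary: i j)
  case (Cons t ts)
  have "(Suc i + k) # q \<in> c \<longleftrightarrow> (Suc j + k) # q \<in> d" for k q
    using Cons.prems[of "Suc k" q] by simp
  from Cons.IH[OF this] show ?case using Cons.prems[of 0] by simp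
qed simp

lemma adm_leaf: "adm (Node x []) = {{}}"
proof (rule set_eqI)
  fix c show "c \<in> adm (Node x []) \<longleftrightarrow> c \<in> {{}}"
    by (cases "\<exists>p. p \<in> c") (auto simp: adm_Node, metis list.exhaust)
qed

text \<open>The first sum on the right collects the cuts through the edge to the first child \<open>t\<close>, the second
  one the cuts that leave this edge intact. The summand \<open>G\<close> takes the lists of cut-off and of
  remaining trees at the root, as these lists are concatenated when children are added, whereas trees
  would have to be glued.\<close>

lemma sum_adm_Node_Cons:
  fixes G :: "'a ptree list \<Rightarrow> 'a ptree list \<Rightarrow> 'b::comm_monoid_add"
  shows "(\<Sum>c\<in>adm (Node x (t # ts)). G (cut_off_list c 0 (t # ts)) (trunk_list c 0 (t # ts))) =
    (\<Sum>b\<in>adm (Node x ts). G (t # cut_off_list b 0 ts) (trunk_list b 0 ts)) +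
    (\<Sum>a\<in>adm t. \<Sum>b\<in>adm (Node x ts).
       G (cut_off a t @ cut_off_list b 0 ts) (trunk a t # trunk_list b 0 ts))"
proof -
  \<comment> \<open>A cut is assembled from its part \<open>a\<close> on \<open>t\<close>, where \<open>a = {[]}\<close> encodes the cut through the edge
      to \<open>t\<close>, and its part \<open>b\<close> on the other children, whose indices go up by one.\<close>
  define J :: "nat list set \<times> nat list set \<Rightarrow> nat list set" where
    "J = (\<lambda>(a, b). {p. \<exists>q. p = 0 # q \<and> q \<in> a \<or> (\<exists>i. p = Suc i # q \<and> i # q \<in> b)})"
  have J0: "0 # q \<in> J (a, b) \<longleftrightarrow> q \<in> a" and JS: "Suc i # q \<in> J (a, b) \<longleftrightarrow> i # q \<in> b"
    and JN: "[] \<notin> J (a, b)" for i q a b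
    by (auto simp: J_def)
  define G' where "G' a b = G ((if [] \<in> a then [t] else cut_off a t) @ cut_off_list b 0 ts)
    ((if [] \<in> a then [] else [trunk a t]) @ trunk_list b 0 ts)" for a b
  have GJ: "G (cut_off_list (J ab) 0 (t # ts)) (trunk_list (J ab) 0 (t # ts)) =
      (case ab of (a, b) \<Rightarrow> G' a b)" for ab
  proof (cases ab)
    case (Pair a b)
    have "cut_off_list (J ab) 1 ts = cut_off_list b 0 ts \<and> trunk_list (J ab) 1 ts = trunk_list b 0 ts"
      by (rule cut_list_shift) (simp add: Pair JS)
    then show ?thesis by (simp add: Pair J0 G'_def)
  qed
  have admJ: "J (a, b) \<in> adm (Node x (t # ts)) \<longleftrightarrow>
      a \<in> insert {[]} (adm t) \<and> b \<in> adm (Node x ts)" if "[] \<notin> b" for a b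
  proof -
    have "(\<forall>i q. i # q \<in> J (a, b) \<longrightarrow> i < Suc (length ts)) \<longleftrightarrow> (\<forall>i q. i # q \<in> b \<longrightarrow> i < length ts)"
    proof (intro iffI allI impI)
      fix i q assume "\<forall>i q. i # q \<in> J (a, b) \<longrightarrow> i < Suc (length ts)" "i # q \<in> b"
      then show "i < length ts" using JS by blast
    next
      fix i q assume "\<forall>i q. i # q \<in> b \<longrightarrow> i < length ts" "i # q \<in> J (a, b)"
      then show "i < Suc (length ts)" by (cases i) (auto simp: JS)
    qed
    then show ?thesis
      unfolding adm_Node using that by (simp add: All_less_Suc2 J0 JS JN) blast
  qed
  define K where "K c = ({q. 0 # q \<in> c}, {p. \<exists>i q. p = i # q \<and> Suc i # q \<in> c})" for c :: "nat list set"
  have JK: "J (K c) = c" if "c \<in> adm (Node x (t # ts))" for c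
  proof (rule set_eqI)
    fix p show "p \<in> J (K c) \<longleftrightarrow> p \<in> c"
    proof (cases p)
      case Nil
      then show ?thesis using that JN by (simp add: K_def adm_Node)
    next
      case (Cons i q)
      then show ?thesis by (cases i) (simp_all add: K_def J0 JS)
    qed
  qed
  have bij: "bij_betw J (insert {[]} (adm t) \<times> adm (Node x ts)) (adm (Node x (t # ts)))"
  proof (rule bij_betwI[where g = K])
    show "J \<in> insert {[]} (adm t) \<times> adm (Node x ts) \<rightarrow> adm (Node x (t # ts))"
      using admJ by (auto simp: adm_Node)
  next
    show "K \<in> adm (Node x (t # ts)) \<rightarrow> insert {[]} (adm t) \<times> adm (Node x ts)"
    proof
      fix c assume c: "c \<in> adm (Node x (t # ts))"
      obtain a b where K: "K c = (a, b)" by (cases "K c")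
      then have "[] \<notin> b" by (auto simp: K_def)
      then show "K c \<in> insert {[]} (adm t) \<times> adm (Node x ts)"
        using admJ[of b a] JK[OF c] c K by simp
    qed
  next
    fix ab assume "ab \<in> insert {[]} (adm t) \<times> adm (Node x ts)"
    moreover obtain a b where ab: "ab = (a, b)" by (cases ab)
    ultimately have N: "[] \<notin> b" by (simp add: adm_Node)
    have "{p. \<exists>i q. p = i # q \<and> Suc i # q \<in> J ab} = b"
    proof (rule set_eqI)
      fix p show "p \<in> {p. \<exists>i q. p = i # q \<and> Suc i # q \<in> J ab} \<longleftrightarrow> p \<in> b"
        using N by (cases p) (simp_all add: ab JS)
    qed
    then show "K (J ab) = ab" by (simp add: K_def ab J0)
  qed (rule JK)
  have ne: "{[]} \<notin> adm t" "\<And>a. a \<in> adm t \<Longrightarrow> [] \<notin> a" by (auto simp: adm_def)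
  have "(\<Sum>c\<in>adm (Node x (t # ts)). G (cut_off_list c 0 (t # ts)) (trunk_list c 0 (t # ts))) =
      (\<Sum>ab\<in>insert {[]} (adm t) \<times> adm (Node x ts). case ab of (a, b) \<Rightarrow> G' a b)"
    unfolding GJ[symmetric] by (rule sum.reindex_bij_betw[OF bij, symmetric])
  also have "\<dots> = (\<Sum>a\<in>insert {[]} (adm t). \<Sum>b\<in>adm (Node x ts). G' a b)"
    by (simp add: sum.cartesian_product)
  also have "\<dots> = (\<Sum>b\<in>adm (Node x ts). G' {[]} b) + (\<Sum>a\<in>adm t. \<Sum>b\<in>adm (Node x ts). G' a b)"
    using ne(1) by (simp add: finite_adm)
  finally show ?thesis using ne(2) by (simp add: G'_def)
qed


section \<open>Cuts of the two kinds of ladders\<close>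

text \<open>The summand is kept arbitrary because the induction step needs the hypothesis for another one, in
  which the trunk is lengthened by the new lowest edge. The cut through that edge is the extra term.\<close>

lemma sum_adm_ladder:
  fixes F :: "bool ptree \<Rightarrow> bool ptree \<Rightarrow> 'b::comm_monoid_add"
  shows "(\<Sum>c\<in>adm (ladder n). F (pruned c (ladder n)) (trunk c (ladder n))) =
    (\<Sum>k=0..n. F (ladder k) (ladder (n - k)))"
proof (induction n arbitrary: F)
  case 0
  show ?case by (simp add: adm_leaf)
next
  case (Suc n)
  let ?G = "\<lambda>p r. F (Node False p) (Node False r)"
  have "(\<Sum>c\<in>adm (ladder (Suc n)). F (pruned c (ladder (Suc n))) (trunk c (ladder (Suc n)))) =
      (\<Sum>c\<in>adm (Node False [ladder n]). ?G (cut_off_list c 0 [ladder n]) (trunk_list c 0 [ladder n]))"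
    by simp
  also have "\<dots> = F (ladder (Suc n)) (ladder 0) +
      (\<Sum>a\<in>adm (ladder n). F (pruned a (ladder n)) (Node False [trunk a (ladder n)]))"
    by (subst sum_adm_Node_Cons[of ?G]) (simp add: adm_leaf pruned_eq)
  also have "(\<Sum>a\<in>adm (ladder n). F (pruned a (ladder n)) (Node False [trunk a (ladder n)])) =
      (\<Sum>k=0..n. F (ladder k) (Node False [ladder (n - k)]))"
    by (rule Suc.IH)
  also have "\<dots> = (\<Sum>k=0..n. F (ladder k) (ladder (Suc n - k)))"
    by (intro sum.cong) (simp_all add: Suc_diff_le)
  finally show ?case by (simp add: add.commute)
qed

text \<open>The coloured node is the first child of the root. If its edge is cut it is glued to the pruned
  part of the ladder, and otherwise to the trunk. The second half of the sum is
  then reversed to match the shape of the coproduct of \<open>Ht n\<close>.\<close>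

lemma sum_adm_dladder:
  fixes F :: "bool ptree \<Rightarrow> bool ptree \<Rightarrow> 'b::comm_monoid_add"
  shows "(\<Sum>c\<in>adm (dladder n). F (pruned c (dladder n)) (trunk c (dladder n))) =
    (\<Sum>k=0..n. F (dladder k) (ladder (n - k)) + F (ladder (n - k)) (dladder k))"
proof -
  let ?col = "Node True [] :: bool ptree"
  \<comment> \<open>\<open>?bud\<close> adds the coloured node at the root; it maps \<open>ladder k\<close> to \<open>dladder k\<close>.\<close>
  let ?bud = "glue (Node False [?col])"
  let ?G = "\<lambda>p r. F (Node False p) (Node False r)"
  obtain ts where ts: "ladder n = Node False ts" using root_ladder by blast
  have d: "dladder n = Node False (?col # ts)" by (rule dladder_eq[OF ts])
  have "(\<Sum>c\<in>adm (dladder n). F (pruned c (dladder n)) (trunk c (dladder n))) =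
      (\<Sum>c\<in>adm (Node False (?col # ts)).
        ?G (cut_off_list c 0 (?col # ts)) (trunk_list c 0 (?col # ts)))"
    by (simp add: d)
  also have "\<dots> = (\<Sum>b\<in>adm (ladder n). F (?bud (pruned b (ladder n))) (trunk b (ladder n))) +
      (\<Sum>b\<in>adm (ladder n). F (pruned b (ladder n)) (?bud (trunk b (ladder n))))"
    by (subst sum_adm_Node_Cons[of ?G]) (simp add: adm_leaf ts)
  also have "\<dots> = (\<Sum>k=0..n. F (dladder k) (ladder (n - k))) + (\<Sum>k=0..n. F (ladder k) (dladder (n - k)))"
    using sum_adm_ladder[of "\<lambda>p r. F (?bud p) r" n] sum_adm_ladder[of "\<lambda>p r. F p (?bud r)" n]
    by (simp add: dladder_def)
  also have "(\<Sum>k=0..n. F (ladder k) (dladder (n - k))) = (\<Sum>k=0..n. F (ladder (n - k)) (dladder k))"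
    by (rule sum.reindex_bij_witness[of _ "\<lambda>k. n - k" "\<lambda>k. n - k"]) auto
  finally show ?thesis by (simp add: sum.distrib)
qed

lemma coproduct_entry_tree:
  "coproduct (tree_elt (entry_tree e)) =
    (\<Sum>c\<in>adm (entry_tree e). tree_elt (pruned c (entry_tree e)) \<otimes> tree_elt (trunk c (entry_tree e)))"
proof (cases e)
  case (Plain m)
  then show ?thesis
    using sum_adm_ladder[of "\<lambda>p r. tree_elt p \<otimes> tree_elt r"]
    by (simp add: tree_elt_ladder coproduct_H)
next
  case (Dotted n)
  then show ?thesis
    using sum_adm_dladder[of "\<lambda>p r. tree_elt p \<otimes> tree_elt r"]
    by (simp add: tree_elt_ladder tree_elt_dladder coproduct_Ht)
qed

lemma adm_forest_Cons: "adm_forest (t # ts) = (\<lambda>(c, cs). c # cs) ` (adm t \<times> adm_forest ts)"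
  by (auto simp: adm_forest_def list_all2_Cons2)

section \<open>Coloured nodes and labels\<close>

text \<open>For forests of trees \<open>ladder n\<close> and \<open>dladder n\<close> this is the degree \<open>df\<close> of the corresponding basis element.\<close>

definition coloured :: "bool ptree list \<Rightarrow> nat" where
  "coloured ts = length (filter (\<lambda>b. b) (concat (map preorder ts)))"

lemma coloured_Nil [simp]: "coloured [] = 0"
  by (simp add: coloured_def)

lemma coloured_Cons: "coloured (t # ts) = coloured [t] + coloured ts"
  by (simp add: coloured_def)

lemma labels_eq: "labels ts = map the (filter (\<lambda>x. x \<noteq> None) (concat (map preorder ts)))"
proof -
  have "[i. Some i \<leftarrow> xs] = map the (filter (\<lambda>x. x \<noteq> None) xs)" for xs :: "nat option list"
    by (induction xs) (auto split: option.split)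
  then show ?thesis by (simp add: labels_def)
qed

lemma labels_Cons: "labels (t # ts) = labels [t] @ labels ts"
  by (simp add: labels_eq)

lemma preorder_map: "preorder (map_ptree f t) = map f (preorder t)"
proof (induction t)
  case (Node x ts)
  then have "map (preorder \<circ> map_ptree f) ts = map (map f \<circ> preorder) ts" by simp
  then show ?case by (simp add: map_concat del: map_eq_conv)
qed

text \<open>Cutting only looks at the shape of a tree and hence commutes with any change of decorations. This is
  used to shift all labels by one, and to forget them.\<close>

lemma trunk_map: "trunk c (map_ptree f t) = map_ptree f (trunk c t)"
  and trunk_list_map: "trunk_list c i (map (map_ptree f) ts) = map (map_ptree f) (trunk_list c i ts)"
  by (induction c t and c i ts rule: trunk_trunk_list.induct) simp_all

lemma cut_off_map: "cut_off c (map_ptree f t) = map (map_ptree f) (cut_off c t)"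
  and cut_off_list_map:
    "cut_off_list c i (map (map_ptree f) ts) = map (map_ptree f) (cut_off_list c i ts)"
  by (induction c t and c i ts rule: cut_off_cut_off_list.induct) simp_all

lemma pruned_map: "pruned c (map_ptree f t) = map_ptree f (pruned c t)"
  by (cases t) (simp add: cut_off_list_map)

lemma P_cut_Cons: "P_cut (c # cs) (t # ts) = pruned c t # P_cut cs ts"
  by (simp add: P_cut_def)

lemma R_cut_Cons: "R_cut (c # cs) (t # ts) = trunk c t # R_cut cs ts"
  by (simp add: R_cut_def)

lemma R_cut_map: "R_cut cs (map (map_ptree f) ts) = map (map_ptree f) (R_cut cs ts)"
  by (simp add: R_cut_def zip_map2 case_prod_unfold trunk_map comp_def)

lemma P_cut_map: "P_cut cs (map (map_ptree f) ts) = map (map_ptree f) (P_cut cs ts)"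
  by (simp add: P_cut_def zip_map2 case_prod_unfold pruned_map comp_def)

lemma labels_map_Suc: "labels (map (map_ptree (map_option Suc)) ts) = map Suc (labels ts)"
proof -
  have "map the (filter (\<lambda>x. x \<noteq> None) (map (map_option Suc) xs)) =
      map Suc (map the (filter (\<lambda>x. x \<noteq> None) xs))" for xs
    by (induction xs) auto
  moreover have "concat (map preorder (map (map_ptree (map_option Suc)) ts)) =
      map (map_option Suc) (concat (map preorder ts))"
    by (simp add: preorder_map map_concat comp_def)
  ultimately show ?thesis by (simp only: labels_eq)
qed

lemma number_Suc: "number (Suc k) t = map_ptree (map_option Suc) (number k t)"
  and number_list_Suc: "number_list (Suc k) ts = map (map_ptree (map_option Suc)) (number_list k ts)"
  by (induction k t and k ts rule: number_number_list.induct) (simp_all split: if_splits)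

lemma erase_number: "map_ptree (\<lambda>x. x \<noteq> None) (number k t) = t"
  and erase_number_list: "map (map_ptree (\<lambda>x. x \<noteq> None)) (number_list k ts) = ts"
  by (induction k t and k ts rule: number_number_list.induct) simp_all

lemma coloured_erase: "coloured (map (map_ptree (\<lambda>x. x \<noteq> None)) ts) = length (labels ts)"
proof -
  have "concat (map preorder (map (map_ptree (\<lambda>x. x \<noteq> None)) ts)) =
      map (\<lambda>x. x \<noteq> None) (concat (map preorder ts))"
    by (simp add: preorder_map map_concat comp_def)
  then show ?thesis by (simp only: coloured_def labels_eq filter_map length_map comp_def)
qed

lemma length_labels_number_list:
  "length (labels (P_cut cs (number_list k ts))) = coloured (P_cut cs ts)"
  "length (labels (R_cut cs (number_list k ts))) = coloured (R_cut cs ts)"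
  unfolding coloured_erase[symmetric] P_cut_map[symmetric] R_cut_map[symmetric] erase_number_list
  by simp_all

text \<open>Labels are given out in preorder, the same order in which they are read off.\<close>

lemma labels_number: "labels [number k t] = [k..<k + coloured [t]]"
  and labels_number_list: "labels (number_list k ts) = [k..<k + coloured ts]"
proof (induction k t and k ts rule: number_number_list.induct)
  case (1 k b ts)
  then show ?case
    by (cases b) (simp_all add: labels_eq coloured_def upt_conv_Cons del: upt_Suc)
next
  case (2 k)
  show ?case by (simp add: labels_eq)
next
  case (3 k t ts)
  let ?m = "length (filter (\<lambda>b. b) (preorder t))"
  have "labels (number_list k (t # ts)) = labels [number k t] @ labels (number_list (k + ?m) ts)"
    by (simp add: labels_eq)
  also have "\<dots> = [k..<k + ?m] @ [k + ?m..<k + ?m + coloured ts]"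
    using 3 by (simp add: coloured_def)
  also have "\<dots> = [k..<k + ?m + coloured ts]"
    by (rule upt_add_eq_append[symmetric]) simp
  finally show ?case by (simp add: coloured_def add.assoc)
qed

text \<open>No node is lost or duplicated by a cut. The root is kept in the trunk only, as the cut-off
  subtrees are taken here without a root joining them.\<close>

lemma mset_preorder_cut:
  fixes t :: "'a ptree" and ts :: "'a ptree list"
  shows "mset (concat (map preorder (cut_off c t))) + mset (preorder (trunk c t)) = mset (preorder t)"
  and mset_preorder_cut_list:
  "mset (concat (map preorder (cut_off_list c i ts))) + mset (concat (map preorder (trunk_list c i ts))) =
    mset (concat (map preorder ts))"
proof (induction c t and c i ts rule: cut_off_cut_off_list.induct)
  case (3 c i t ts)
  show ?case
  proof (cases "[i] \<in> c")
    case False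
    then show ?thesis using 3(1)[OF False] 3(2) by (simp add: ac_simps)
  qed (use 3 in \<open>simp add: ac_simps\<close>)
qed simp_all

text \<open>Both parts of a cut have a copy of the root, so a label of the root would be read twice. All other
  labels are redistributed.\<close>

lemma mset_labels_cut:
  assumes "t = Node None us"
  shows "mset (labels [pruned c t] @ labels [trunk c t]) = mset (labels [t])"
proof -
  have "mset (concat (map preorder (cut_off_list c 0 us))) + mset (concat (map preorder (trunk_list c 0 us))) =
    mset (concat (map preorder us))"
    by (rule mset_preorder_cut_list)
  then have "image_mset the (filter_mset (\<lambda>x. x \<noteq> None) (mset (concat (map preorder (cut_off_list c 0 us))) +
      mset (concat (map preorder (trunk_list c 0 us))))) =
      image_mset the (filter_mset (\<lambda>x. x \<noteq> None) (mset (concat (map preorder us))))"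
    by simp
  then show ?thesis by (simp add: assms labels_eq)
qed

lemma mset_labels_forest_cut:
  assumes "length cs = length ts" "\<And>t. t \<in> set ts \<Longrightarrow> \<exists>us. t = Node False us"
  shows "mset (labels (P_cut cs (number_list k ts)) @ labels (R_cut cs (number_list k ts))) =
    mset [k..<k + coloured ts]"
proof -
  have "mset (labels (P_cut cs ns) @ labels (R_cut cs ns)) = mset (labels ns)"
    if "length cs = length ns" "\<And>t. t \<in> set ns \<Longrightarrow> \<exists>us. t = Node None us" for ns
    using that
  proof (induction cs ns rule: list_induct2)
    case (Cons c cs t ns)
    have "mset (labels [t]) = mset (labels [pruned c t] @ labels [trunk c t])"
      using Cons.prems[of t] mset_labels_cut[of t _ c] by auto
    moreover have "mset (labels ns) = mset (labels (P_cut cs ns) @ labels (R_cut cs ns))"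
      using Cons.IH Cons.prems by simp
    ultimately show ?case
      by (simp add: P_cut_Cons R_cut_Cons labels_Cons[of _ "P_cut cs ns"] labels_Cons[of _ "R_cut cs ns"] labels_Cons[of t ns]
          ac_simps)
  qed (simp add: P_cut_def R_cut_def labels_eq)
  moreover have "\<exists>us. s = Node None us" if "s \<in> set (number_list k ts)" for s
    using that assms(2) by (induction ts arbitrary: k) (simp, fastforce)
  moreover have "length (number_list k ts) = length ts"
    using arg_cong[OF erase_number_list, of length k ts] by simp
  ultimately show ?thesis using assms(1) by (simp only: labels_number_list)
qed


section \<open>The sign of a cut, tree by tree\<close>

lemma one_line_permutes:
  assumes "mset w = mset [1..<Suc n]"
  shows "one_line w permutes {1..n}"
proof (rule bij_imp_permutes)
  have len: "length w = n" using mset_eq_length[OF assms] by simp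
  have set: "set w = {1..n}" using mset_eq_setD[OF assms]
    by (simp add: atLeastLessThanSuc_atLeastAtMost del: upt_Suc)
  have dist: "distinct w" using mset_eq_imp_distinct_iff[OF assms] by (simp del: upt_Suc)
  have "inj_on (one_line w) {1..n}"
    using dist len by (auto simp: inj_on_def one_line_def nth_eq_iff_index_eq)
  moreover have "one_line w ` {1..n} \<subseteq> {1..n}"
    using nth_mem[of _ w] unfolding set len by (fastforce simp: one_line_def len)
  ultimately show "bij_betw (one_line w) {1..n} {1..n}"
    by (simp add: bij_betw_def card_subset_eq card_image)
  show "one_line w i = i" if "i \<notin> {1..n}" for i
    using that len by (auto simp: one_line_def)
qed

lemma one_line_permutation:
  "mset w = mset [1..<Suc n] \<Longrightarrow> permutation (one_line w)"
  using one_line_permutes permutation_permutes by blast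

text \<open>Exchanging two neighbouring letters of a word composes its permutation, on the side of the
  positions, with an adjacent transposition.\<close>

lemma one_line_swap:
  "one_line (u @ b # a # v) =
    one_line (u @ a # b # v) \<circ> transpose (Suc (length u)) (Suc (Suc (length u)))"
proof
  fix i
  consider "i \<le> length u" | "i = Suc (length u)" | "i = Suc (Suc (length u))"
    | "i > Suc (Suc (length u))" by linarith
  then show "one_line (u @ b # a # v) i = (one_line (u @ a # b # v) \<circ>
      transpose (Suc (length u)) (Suc (Suc (length u)))) i"
  proof cases
    case 4
    then have "\<exists>k. i = Suc (Suc (Suc (length u + k)))"
      by (metis add_Suc less_imp_Suc_add)
    then show ?thesis by (auto simp: one_line_def nth_append transpose_def)
  qed (auto simp: one_line_def nth_append transpose_def)
qed

text \<open>The letter \<open>a\<close> is moved to the front by \<open>length u\<close> exchanges with its left neighbour.\<close>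

lemma sign_one_line_move:
  assumes "mset (u @ a # v) = mset [1..<Suc n]"
  shows "sign (one_line (u @ a # v)) = (-1) ^ length u * sign (one_line (a # u @ v))"
  using assms
proof (induction u arbitrary: v rule: rev_induct)
  case (snoc b u)
  have m: "mset (u @ a # b # v) = mset [1..<Suc n]"
    using snoc.prems by (simp add: add_mset_commute del: upt_Suc)
  have "sign (one_line ((u @ [b]) @ a # v)) = - sign (one_line (u @ a # b # v))"
    using one_line_permutation[OF m]
    by (simp add: one_line_swap[of u b] sign_compose permutation_swap_id sign_swap_id)
  then show ?case using snoc.IH[OF m] by simp
qed simp

text \<open>A new fixed point at the front does not change the sign: the new permutation is the old one
  conjugated by the successor function.\<close>

lemma sign_one_line_Cons:
  assumes "mset w = mset [1..<Suc n]"
  shows "sign (one_line (1 # map Suc w)) = sign (one_line w)"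
proof -
  have len: "length w = n" using mset_eq_length[OF assms] by simp
  have "one_line (1 # map Suc w) = map_permutation {1..n} Suc (one_line w)"
  proof
    fix i
    show "one_line (1 # map Suc w) i = map_permutation {1..n} Suc (one_line w) i"
    proof (cases "i \<in> Suc ` {1..n}")
      case True
      then obtain k where k: "i = Suc k" "k \<in> {1..n}" by blast
      then obtain j where "k = Suc j" by (cases k) auto
      then show ?thesis
        using k len map_permutation_apply[of Suc "{1..n}" "Suc j" "one_line w"]
        by (simp add: one_line_def)
    next
      case False
      then have "i \<le> 1 \<or> i > Suc n" by (auto simp: image_iff)
      then show ?thesis using False len
        by (auto simp: map_permutation_def restrict_id_def one_line_def)
    qed
  qed
  then show ?thesis
    using sign_map_permutation[OF _ one_line_permutes[OF assms], of Suc] by simp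
qed

text \<open>If \<open>t\<close> has a coloured node, it gets the label \<open>1\<close> and the other labels go up by one. If this node is pruned, its label comes first. If it stays in the
  trunk, the label comes right after the labels of the pruned part of the rest, and moving it
  to the front costs one sign for each of them.\<close>

lemma sgn_cut_Cons:
  assumes "length cs = length ts" "\<And>s. s \<in> set (t # ts) \<Longrightarrow> \<exists>us. s = Node False us"
    and "coloured [t] \<le> 1"
  shows "sgn_cut (t # ts) (c # cs) = (-1) ^ (coloured [trunk c t] * coloured (P_cut cs ts)) * sgn_cut ts cs"
proof -
  let ?n = "number 1 t"
  define p r where "p = labels [pruned c ?n]" and "r = labels [trunk c ?n]"
  define x y where "x = labels (P_cut cs (number_list 1 ts))"
    and "y = labels (R_cut cs (number_list 1 ts))"
  have xy: "mset (x @ y) = mset [1..<Suc (coloured ts)]"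
    unfolding x_def y_def using mset_labels_forest_cut[OF assms(1), of 1] assms(2) by simp
  have r: "length r = coloured [trunk c t]"
  proof -
    have "map_ptree (\<lambda>x. x \<noteq> None) (trunk c ?n) = trunk c t"
      unfolding trunk_map[symmetric] erase_number ..
    then show ?thesis
      using coloured_erase[of "[trunk c ?n]"] by (simp only: list.map r_def)
  qed
  have x: "length x = coloured (P_cut cs ts)"
    unfolding x_def by (rule length_labels_number_list)
  obtain us where "t = Node False us" using assms(2) by auto
  then have pr: "mset (p @ r) = mset [1..<Suc (coloured [t])]"
    unfolding p_def r_def using mset_labels_cut[of ?n] labels_number[of 1 t] by simp
  consider "coloured [t] = 0" | "coloured [t] = 1" using assms(3) by linarith
  then show ?thesis
  proof cases
    case 1
    then have "p = []" "r = []" using pr by auto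
    moreover have "number_list 1 (t # ts) = ?n # number_list 1 ts"
      using 1 by (simp add: coloured_def)
    ultimately have "sgn_cut (t # ts) (c # cs) = sgn_cut ts cs"
      by (simp add: sgn_cut_def P_cut_def R_cut_def labels_Cons[of _ "map2 _ _ _"] p_def r_def Let_def)
    then show ?thesis using r \<open>r = []\<close> by simp
  next
    case 2
    \<comment> \<open>The other trees are numbered from \<open>2\<close>, which is the numbering from \<open>1\<close> shifted by one.\<close>
    have "number_list 1 (t # ts) = ?n # map (map_ptree (map_option Suc)) (number_list 1 ts)"
      using 2 by (simp add: coloured_def flip: number_list_Suc)
    then have s: "sgn_cut (t # ts) (c # cs) = of_int (sign (one_line ((p @ map Suc x) @ r @ map Suc y)))"
      unfolding sgn_cut_def Let_def x_def y_def p_def r_def labels_map_Suc[symmetric] P_cut_map[symmetric]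
        R_cut_map[symmetric]
      by (simp add: P_cut_def R_cut_def labels_Cons[of _ "map2 _ _ _"])
    have s': "sgn_cut ts cs = of_int (sign (one_line (x @ y)))"
      by (simp add: sgn_cut_def x_def y_def Let_def)
    have "p @ r = [1]" using pr 2 by (simp del: mset_append)
    then consider "p = [1]" "r = []" | "p = []" "r = [1]"
      by (auto simp: append_eq_Cons_conv)
    then show ?thesis
    proof cases
      case 1
      then show ?thesis using s s' r sign_one_line_Cons[OF xy] by simp
    next
      case 2
      have "mset (map Suc x @ 1 # map Suc y) = add_mset 1 (mset (map Suc (x @ y)))" by simp
      also have "\<dots> = mset (1 # map Suc [1..<Suc (coloured ts)])"
        by (simp only: mset_map xy mset.simps)
      also have "1 # map Suc [1..<Suc (coloured ts)] = [1..<Suc (Suc (coloured ts))]"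
        using upt_conv_Cons[of 1 "Suc (Suc (coloured ts))"] by (simp add: map_Suc_upt del: upt_Suc)
      finally have "mset (map Suc x @ 1 # map Suc y) = mset [1..<Suc (Suc (coloured ts))]" .
      from sign_one_line_move[OF this]
      moreover have one: "coloured [trunk c t] = 1" using 2 r by simp
      ultimately show ?thesis
        unfolding one using 2 s s' x sign_one_line_Cons[OF xy] by simp
    qed
  qed
qed


section \<open>The coproduct formula\<close>

lemma homogeneous_mult:
  assumes "homogeneous d f" "homogeneous e g"
  shows "homogeneous (d + e) (f * g)"
  unfolding homogeneous_def
proof
  fix \<alpha> assume "\<alpha> \<in> Poly_Mapping.keys (f * g)"
  then obtain a b where "\<alpha> = a + b" "a \<in> Poly_Mapping.keys f" "b \<in> Poly_Mapping.keys g"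
    using keys_mult[of f g] by auto
  then show "df \<alpha> = d + e" using assms by (simp add: homogeneous_def)
qed

lemma coloured_ladder: "coloured [ladder n] = 0"
  by (induction n) (simp_all add: coloured_def)

lemma coloured_dladder: "coloured [dladder n] = 1"
proof -
  obtain ts where ts: "ladder n = Node False ts" using root_ladder by blast
  then show ?thesis using coloured_ladder[of n] by (simp add: dladder_eq[OF ts] coloured_def)
qed

lemma forest_elt_Cons: "forest_elt (t # ts) = tree_elt t * forest_elt ts"
  by (simp add: forest_elt_def)

lemma homogeneous_H: "homogeneous 0 (H n)"
  by (cases "n = 0") (simp_all add: homogeneous_def H_def H_comp_def df_def zero_dcomp_def)

lemma homogeneous_Ht: "homogeneous 1 (Ht n)"
  by (simp add: homogeneous_def Ht_def H_comp_def df_def)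

text \<open>The restriction on \<open>t\<close> is essential, as \<open>tree_elt\<close> sends every other tree to some \<open>Ht n\<close>, whatever
  its number of coloured nodes.\<close>

lemma homogeneous_tree_elt:
  assumes "t \<in> range ladder \<union> range dladder"
  shows "homogeneous (coloured [t]) (tree_elt t)"
proof -
  from assms consider n where "t = ladder n" | n where "t = dladder n" by blast
  then show ?thesis
    by cases (simp_all only: tree_elt_ladder tree_elt_dladder coloured_ladder coloured_dladder
        homogeneous_H homogeneous_Ht)
qed

lemma homogeneous_forest_elt:
  "set ts \<subseteq> range ladder \<union> range dladder \<Longrightarrow> homogeneous (coloured ts) (forest_elt ts)"
proof (induction ts)
  case Nil
  show ?case by (simp add: forest_elt_def homogeneous_def)
next
  case (Cons t ts)
  then show ?case
    using homogeneous_mult[OF homogeneous_tree_elt[of t]]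
    by (simp add: forest_elt_Cons coloured_Cons[of t ts])
qed

lemma entry_tree_cuts:
  "trunk c (entry_tree e) \<in> range ladder \<union> range dladder"
  "pruned c (entry_tree e) \<in> range ladder \<union> range dladder"
  using trunk_ladder pruned_ladder trunk_dladder pruned_dladder by (cases e; simp; blast)+

lemma root_entry_tree: "\<exists>us. entry_tree e = Node False us"
  using root_ladder dladder_eq by (cases e) (simp_all, metis+)

lemma coloured_entry_tree: "coloured [entry_tree e] \<le> 1"
  by (cases e) (simp_all add: coloured_ladder coloured_dladder)

theorem proposition7p1:
  fixes \<alpha> :: dcomp
  shows "coproduct (forest_elt (comp_forest \<alpha>)) =
    (\<Sum>c\<in>adm_forest (comp_forest \<alpha>).
       scale (sgn_cut (comp_forest \<alpha>) c)
         (forest_elt (P_cut c (comp_forest \<alpha>)) \<otimes> forest_elt (R_cut c (comp_forest \<alpha>))))"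
proof -
  have tmul_sum: "sum X A \<odot> sum Y B = (\<Sum>a\<in>A. \<Sum>b\<in>B. X a \<odot> Y b)"
    for X :: "nat list set \<Rightarrow> snsym2" and Y :: "nat list set list \<Rightarrow> snsym2" and A B
  proof -
    have "Z \<odot> sum Y B = (\<Sum>b\<in>B. Z \<odot> Y b)" for Z
      by (induction B rule: infinite_finite_induct) (simp_all add: tmul_add)
    then show ?thesis
      by (induction A rule: infinite_finite_induct) (simp_all add: tmul_add sum.distrib)
  qed
  have "coproduct (forest_elt ts) =
      (\<Sum>c\<in>adm_forest ts. scale (sgn_cut ts c) (forest_elt (P_cut c ts) \<otimes> forest_elt (R_cut c ts)))"
    if "ts = map entry_tree es" for ts es
    using that
  proof (induction es arbitrary: ts)
    case Nil
    have "one_line [] = id" by (auto simp: one_line_def)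
    then show ?case
      using Nil by (simp add: forest_elt_def coproduct_one adm_forest_def P_cut_def R_cut_def
          sgn_cut_def labels_eq tone_def)
  next
    case (Cons e es)
    define t us where "t = entry_tree e" and "us = map entry_tree es"
    let ?T = "\<lambda>ts cs. forest_elt (P_cut cs ts) \<otimes> forest_elt (R_cut cs ts)"
    have ts: "ts = t # us" using Cons.prems by (simp add: t_def us_def)
    have step: "tree_elt (pruned c t) \<otimes> tree_elt (trunk c t) \<odot> scale (sgn_cut us cs) (?T us cs) =
        scale (sgn_cut ts (c # cs)) (?T ts (c # cs))" if "cs \<in> adm_forest us" for c cs
    proof -
      have len: "length cs = length us"
        using that by (simp add: adm_forest_def list_all2_lengthD)
      have "set (P_cut cs us) \<subseteq> range ladder \<union> range dladder"
        using entry_tree_cuts by (fastforce simp: P_cut_def us_def dest: set_zip_rightD)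
      then have hom: "homogeneous (coloured (P_cut cs us)) (forest_elt (P_cut cs us))"
        by (rule homogeneous_forest_elt)
      have hom_t: "homogeneous (coloured [trunk c t]) (tree_elt (trunk c t))"
        unfolding t_def by (rule homogeneous_tree_elt[OF entry_tree_cuts(1)])
      have "sgn_cut ts (c # cs) =
          (-1) ^ (coloured [trunk c t] * coloured (P_cut cs us)) * sgn_cut us cs"
        unfolding ts
        by (rule sgn_cut_Cons[OF len])
          (use root_entry_tree coloured_entry_tree in \<open>auto simp: t_def us_def\<close>)
      then show ?thesis
        by (simp add: ts tmul_scale tmul_tensor[OF hom_t hom] forest_elt_Cons P_cut_Cons R_cut_Cons
            mult.commute)
    qed
    have "coproduct (forest_elt ts) = coproduct (tree_elt t) \<odot> coproduct (forest_elt us)"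
      by (simp add: ts forest_elt_Cons coproduct_mult)
    also have "\<dots> = (\<Sum>c\<in>adm t. \<Sum>cs\<in>adm_forest us.
        (tree_elt (pruned c t) \<otimes> tree_elt (trunk c t)) \<odot> scale (sgn_cut us cs) (?T us cs))"
      unfolding Cons.IH[OF us_def] t_def coproduct_entry_tree by (rule tmul_sum)
    also have "\<dots> = (\<Sum>c\<in>adm t. \<Sum>cs\<in>adm_forest us. scale (sgn_cut ts (c # cs)) (?T ts (c # cs)))"
      by (intro sum.cong refl step)
    also have "\<dots> = (\<Sum>cs\<in>adm_forest ts. scale (sgn_cut ts cs) (?T ts cs))"
      unfolding ts adm_forest_Cons
      by (subst sum.reindex) (auto simp: inj_on_def sum.cartesian_product case_prod_unfold)
    finally show ?case .
  qed
  then show ?thesis by (simp add: comp_forest_def)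
qed

end
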